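(* If the channel prediction error is not zero, i.e. if $$\lim_{k\to\infty}\left(1-D_k^\dagger\Delta_{k-1}^{-1}D_k\right)>0,$$ then the effective coherence time $\hat T_{\rm c}$ defined in the context satisfies $$\lim_{p_x\to\infty}\hat T_{\rm c}(p_x)=N.$$
   Context: Let $N\ge1$ be an integer. Let $(\Delta_k)_{k\ge0}$ be the covariance matrices of a stationary unit-variance complex Gaussian sequence (the common normalized autocorrelation of the channel taps): $\Delta_k$ is a $(k+1)\times(k+1)$ Hermitian positive semi-definite Toeplitz matrix with unit diagonal, with rows and columns indexed by $0,\dots,k$, and $\Delta_{k-1}$ is the leading principal $k\times k$ submatrix of $\Delta_k$. Let $D_k\in\mathbb C^k$ be the vector with entries $(\Delta_k)_{i,k}$, $i=0,\dots,k-1$. In the hypothesis of the claim the matrices $\Delta_{k-1}$ are understood to be invertible. The effective coherence time at SNR $p>0$ is $$\hat T_{\rm c}(p)=2N\lim_{k\to\infty}D_k^\dagger\left(Np\,[\Delta_{k-1}-D_kD_k^\dagger]+I\right)^{-1}D_k+N,$$ where $\dagger$ is conjugate transpose. *)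

theory Defs
  imports
    Complex_Main
    "Jordan_Normal_Form.Gauss_Jordan_Elimination"
begin

definition mat_adj :: "complex mat \<Rightarrow> complex mat" where
  "mat_adj A = map_mat cnj (transpose_mat A)"

definition hermitian_mat :: "complex mat \<Rightarrow> bool" where
  "hermitian_mat A \<longleftrightarrow> square_mat A \<and> mat_adj A = A"

definition sesq_form :: "complex vec \<Rightarrow> complex mat \<Rightarrow> complex" where
  "sesq_form v A = conjugate v \<bullet> (A *\<^sub>v v)"

(* The order on complex is that of HOL-Library.Complex_Order:
   0 \<le> z means that z is real and nonnegative. *)
definition psd_mat :: "complex mat \<Rightarrow> bool" where
  "psd_mat A \<longleftrightarrow> hermitian_mat A \<and> (\<forall>v \<in> carrier_vec (dim_row A). 0 \<le> sesq_form v A)"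

definition toeplitz_mat :: "'a mat \<Rightarrow> bool" where
  "toeplitz_mat A \<longleftrightarrow>
     (\<forall>i j. Suc i < dim_row A \<longrightarrow> Suc j < dim_col A \<longrightarrow> A $$ (Suc i, Suc j) = A $$ (i, j))"

definition leading_principal :: "nat \<Rightarrow> 'a mat \<Rightarrow> 'a mat" where
  "leading_principal n A = mat n n (\<lambda>(i, j). A $$ (i, j))"

(* The covariance matrices of a stationary unit-variance complex sequence;
   \<Delta> k has size (k + 1) x (k + 1). *)
definition stationary_covariances :: "(nat \<Rightarrow> complex mat) \<Rightarrow> bool" where
  "stationary_covariances \<Delta> \<longleftrightarrow>
     (\<forall>k. \<Delta> k \<in> carrier_mat (k + 1) (k + 1) \<and> psd_mat (\<Delta> k) \<and> toeplitz_mat (\<Delta> k) \<and>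
          (\<forall>i \<le> k. \<Delta> k $$ (i, i) = 1)) \<and>
     (\<forall>k \<ge> 1. \<Delta> (k - 1) = leading_principal k (\<Delta> k))"

definition cov_vec :: "(nat \<Rightarrow> complex mat) \<Rightarrow> nat \<Rightarrow> complex vec" where
  "cov_vec \<Delta> k = vec k (\<lambda>i. \<Delta> k $$ (i, k))"

definition outer_self :: "complex vec \<Rightarrow> complex mat" where
  "outer_self v = mat (dim_vec v) (dim_vec v) (\<lambda>(i, j). v $ i * cnj (v $ j))"

(* The inverse of an invertible matrix; unspecified for a singular one. *)
definition inv_mat :: "'a :: field mat \<Rightarrow> 'a mat" where
  "inv_mat A = the (mat_inverse A)"

(* In the two sequences below k - 1 is truncated at k = 0, where the matrix sizes do not fit;
   only the terms with k \<ge> 1 are meaningful, and only limits for k to infinity are used. *)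
definition prediction_error :: "(nat \<Rightarrow> complex mat) \<Rightarrow> nat \<Rightarrow> complex" where
  "prediction_error \<Delta> k = 1 - sesq_form (cov_vec \<Delta> k) (inv_mat (\<Delta> (k - 1)))"

definition coherence_term :: "(nat \<Rightarrow> complex mat) \<Rightarrow> nat \<Rightarrow> real \<Rightarrow> nat \<Rightarrow> complex" where
  "coherence_term \<Delta> N p k =
     sesq_form (cov_vec \<Delta> k)
       (inv_mat (of_real (real N * p) \<cdot>\<^sub>m (\<Delta> (k - 1) - outer_self (cov_vec \<Delta> k)) + 1\<^sub>m k))"

(* Complex-valued because the quadratic forms are; no real part is taken. *)
definition coherence_time :: "(nat \<Rightarrow> complex mat) \<Rightarrow> nat \<Rightarrow> real \<Rightarrow> complex" where
  "coherence_time \<Delta> N p = 2 * of_nat N * lim (coherence_term \<Delta> N p) + of_nat N"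

end

(* Write A for \<Delta> (k - 1), D for D_k, q = N p and M = q (A - D D^H) + I.  The k-th term of the
   limit, D^H M^{-1} D, is the maximum over v of 2 Re (v^H D) - v^H M v.  By the Toeplitz structure,
   passing from v to (0, v) leaves this functional unchanged when k is raised by one, so the terms
   increase with k.  If A u = D and the prediction error 1 - u^H A u is at least \<epsilon>, then positivity
   of A at v - conj(v^H D) u gives v^H A v >= (1 + \<epsilon>) |v^H D|^2.  Hence M is positive definite and
   the functional is at most 2 |v^H D| - q \<epsilon> |v^H D|^2 <= 1 / (q \<epsilon>).  So the terms converge in k,
   and their limit is O(1/p). *)
theory Submission
  imports Defs "Jordan_Normal_Form.Determinant"
begin

section \<open>Inverses of square matrices over a field\<close>

lemma inv_mat_right:
  fixes A :: "'a :: field mat"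
  assumes A: "A \<in> carrier_mat n n" and inv: "A \<in> Units (ring_mat TYPE('a) n ())"
  shows "inv_mat A \<in> carrier_mat n n" "A * inv_mat A = 1\<^sub>m n"
proof -
  \<comment> \<open>\<open>mat_inverse\<close> yields \<open>None\<close> only on non-units, so
    \<open>the\<close> inside \<open>inv_mat\<close> meets a proper value.\<close>
  obtain B where B: "mat_inverse A = Some B"
    using mat_inverse(1)[OF A, where b = "()"] inv by (cases "mat_inverse A") auto
  show "inv_mat A \<in> carrier_mat n n" "A * inv_mat A = 1\<^sub>m n"
    using mat_inverse(2)[OF A B] B by (simp_all add: inv_mat_def)
qed

text \<open>\<open>invertible_mat\<close> leaves the shape of the inverse open; comparing column
  counts in the two products with the identity forces it to be n x n.\<close>

lemma invertible_mat_Units: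
  fixes A :: "'a :: field mat"
  assumes A: "A \<in> carrier_mat n n" and inv: "invertible_mat A"
  shows "A \<in> Units (ring_mat TYPE('a) n ())"
proof -
  obtain B where B: "A * B = 1\<^sub>m (dim_row A)" "B * A = 1\<^sub>m (dim_row B)"
    using inv by (auto simp: invertible_mat_def inverts_mat_def)
  have "dim_col B = n" using arg_cong[OF B(1), of dim_col] A by simp
  moreover have "dim_row B = n" using arg_cong[OF B(2), of dim_col] A by simp
  ultimately have "B \<in> carrier_mat n n" by auto
  then show ?thesis using A B by (auto simp: Units_def ring_mat_def)
qed

section \<open>Hermitian and positive semidefinite forms\<close>

lemma hermitian_mat_index:
  assumes "hermitian_mat A" "A \<in> carrier_mat n n" "i < n" "j < n"
  shows "cnj (A $$ (j, i)) = A $$ (i, j)"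
  using assms unfolding hermitian_mat_def mat_adj_def
  by (metis carrier_matD index_map_mat(1) index_transpose_mat)

lemma conjugate_mult_mat_vec_sum:
  fixes A :: "complex mat"
  assumes "A \<in> carrier_mat n n" "v \<in> carrier_vec n" "w \<in> carrier_vec n"
  shows "conjugate v \<bullet> (A *\<^sub>v w) = (\<Sum>i<n. \<Sum>j<n. cnj (v $ i) * A $$ (i, j) * w $ j)"
  using assms by (auto simp: scalar_prod_def sum_distrib_left atLeast0LessThan mult.assoc intro!: sum.cong)

lemma hermitian_form_swap:
  assumes A: "A \<in> carrier_mat n n" "hermitian_mat A"
    and v: "v \<in> carrier_vec n" and w: "w \<in> carrier_vec n"
  shows "conjugate v \<bullet> (A *\<^sub>v w) = cnj (conjugate w \<bullet> (A *\<^sub>v v))"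
proof -
  have "cnj (conjugate w \<bullet> (A *\<^sub>v v)) = (\<Sum>i<n. \<Sum>j<n. cnj (v $ j) * A $$ (j, i) * w $ i)"
    unfolding conjugate_mult_mat_vec_sum[OF A(1) w v] cnj_sum
    by (intro sum.cong refl) (simp add: hermitian_mat_index[OF A(2,1)])
  also have "\<dots> = conjugate v \<bullet> (A *\<^sub>v w)"
    unfolding conjugate_mult_mat_vec_sum[OF A(1) v w] by (rule sum.swap)
  finally show ?thesis by simp
qed

text \<open>The two cross terms of the expansion are conjugate to each other because
  \<open>A\<close> is Hermitian. A free complex \<open>c\<close> serves both uses: c = 1 and c =
  conj(v^H A u).\<close>

lemma sesq_form_diff_smult:
  assumes A: "A \<in> carrier_mat n n" "hermitian_mat A"
    and v: "v \<in> carrier_vec n" and u: "u \<in> carrier_vec n"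
  shows "sesq_form (v - c \<cdot>\<^sub>v u) A = sesq_form v A - c * (conjugate v \<bullet> (A *\<^sub>v u))
     - cnj (c * (conjugate v \<bullet> (A *\<^sub>v u))) + c * cnj c * sesq_form u A"
proof -
  have "sesq_form (v - c \<cdot>\<^sub>v u) A =
      (\<Sum>i<n. \<Sum>j<n. (cnj (v $ i) * A $$ (i, j) * v $ j) - c * (cnj (v $ i) * A $$ (i, j) * u $ j)
       - cnj c * (cnj (u $ i) * A $$ (i, j) * v $ j) + c * cnj c * (cnj (u $ i) * A $$ (i, j) * u $ j))"
    unfolding sesq_form_def using A(1) v u
    by (subst conjugate_mult_mat_vec_sum[of _ n]) (auto simp: algebra_simps intro!: sum.cong)
  also have "\<dots> = sesq_form v A - c * (conjugate v \<bullet> (A *\<^sub>v u))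
     - cnj c * (conjugate u \<bullet> (A *\<^sub>v v)) + c * cnj c * sesq_form u A"
    unfolding sesq_form_def using A(1) v u
    by (simp add: conjugate_mult_mat_vec_sum[of _ n] sum.distrib sum_subtractf sum_distrib_left)
  finally show ?thesis
    using hermitian_form_swap[OF A u v] by simp
qed

text \<open>Equality holds at \<open>v = w\<close>, so \<open>sesq_form w A\<close> is the maximum over \<open>v\<close> of the left-hand side.\<close>
lemma sesq_form_variational:
  assumes A: "A \<in> carrier_mat n n" "psd_mat A"
    and v: "v \<in> carrier_vec n" and w: "w \<in> carrier_vec n"
  shows "2 * Re (conjugate v \<bullet> (A *\<^sub>v w)) - Re (sesq_form v A) \<le> Re (sesq_form w A)"
proof -
  have "0 \<le> sesq_form (v - 1 \<cdot>\<^sub>v w) A"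
    using A v w unfolding psd_mat_def by auto
  moreover have "hermitian_mat A" using A(2) by (simp add: psd_mat_def)
  ultimately show ?thesis
    using sesq_form_diff_smult[OF A(1) _ v w, of 1] by (simp add: less_eq_complex_def)
qed

text \<open>With x = v^H A u and s = u^H A u, positivity at v - conj(x) u makes both cross terms
  |x|^2 and leaves v^H A v - 2 |x|^2 + s |x|^2 >= 0. This multiplier avoids a division by s, which
  may be 0.\<close>

lemma psd_form_lower_bound:
  assumes A: "A \<in> carrier_mat n n" "psd_mat A"
    and v: "v \<in> carrier_vec n" and u: "u \<in> carrier_vec n"
  shows "(2 - Re (sesq_form u A)) * (cmod (conjugate v \<bullet> (A *\<^sub>v u)))\<^sup>2 \<le> Re (sesq_form v A)"
proof -
  let ?x = "conjugate v \<bullet> (A *\<^sub>v u)"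
  have "0 \<le> sesq_form (v - cnj ?x \<cdot>\<^sub>v u) A"
    using A v u unfolding psd_mat_def by auto
  moreover have "hermitian_mat A" using A(2) by (simp add: psd_mat_def)
  ultimately show ?thesis
    using sesq_form_diff_smult[OF A(1) _ v u, of "cnj ?x"]
    by (simp add: less_eq_complex_def complex_norm_square[symmetric] cmod_power2 algebra_simps
        flip: power2_eq_square)
qed

section \<open>The matrix M and its inverse form for one fixed k\<close>

definition coherence_mat :: "real \<Rightarrow> complex mat \<Rightarrow> complex vec \<Rightarrow> complex mat" where
  "coherence_mat q A D = of_real q \<cdot>\<^sub>m (A - outer_self D) + 1\<^sub>m (dim_vec D)"

lemma coherence_mat_carrier:
  assumes "A \<in> carrier_mat n n" "D \<in> carrier_vec n"
  shows "coherence_mat q A D \<in> carrier_mat n n"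
  using assms by (auto simp: coherence_mat_def outer_self_def)

lemma coherence_mat_index:
  assumes "A \<in> carrier_mat n n" "D \<in> carrier_vec n" "i < n" "j < n"
  shows "coherence_mat q A D $$ (i, j) =
    of_real q * (A $$ (i, j) - D $ i * cnj (D $ j)) + (if i = j then 1 else 0)"
  using assms by (auto simp: coherence_mat_def outer_self_def)

lemma coherence_mat_hermitian:
  assumes A: "A \<in> carrier_mat n n" "hermitian_mat A" and D: "D \<in> carrier_vec n"
  shows "hermitian_mat (coherence_mat q A D)"
proof -
  have "mat_adj (coherence_mat q A D) = coherence_mat q A D"
  proof (rule eq_matI)
    fix i j
    assume "i < dim_row (coherence_mat q A D)" "j < dim_col (coherence_mat q A D)"
    then have ij: "i < n" "j < n" using coherence_mat_carrier[OF A(1) D, of q] by auto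
    show "mat_adj (coherence_mat q A D) $$ (i, j) = coherence_mat q A D $$ (i, j)"
      using ij coherence_mat_carrier[OF A(1) D, of q]
      by (auto simp: mat_adj_def coherence_mat_index[OF A(1) D] hermitian_mat_index[OF A(2,1)])
  qed (use coherence_mat_carrier[OF A(1) D, of q] in \<open>auto simp: mat_adj_def\<close>)
  then show ?thesis
    using coherence_mat_carrier[OF A(1) D, of q] by (auto simp: hermitian_mat_def)
qed

lemma sesq_form_coherence_mat:
  assumes A: "A \<in> carrier_mat n n" and D: "D \<in> carrier_vec n" and v: "v \<in> carrier_vec n"
  shows "sesq_form v (coherence_mat q A D) =
    of_real q * (sesq_form v A - (conjugate v \<bullet> D) * cnj (conjugate v \<bullet> D)) + conjugate v \<bullet> v"
proof -
  have x: "conjugate v \<bullet> D = (\<Sum>i<n. cnj (v $ i) * D $ i)"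
    using v D by (auto simp: scalar_prod_def atLeast0LessThan)
  have one: "conjugate v \<bullet> v = (\<Sum>i<n. \<Sum>j<n. if i = j then cnj (v $ i) * v $ j else 0)"
    using v by (auto simp: scalar_prod_def atLeast0LessThan)
  have "sesq_form v (coherence_mat q A D) =
     (\<Sum>i<n. \<Sum>j<n. of_real q * ((cnj (v $ i) * A $$ (i, j) * v $ j)
        - (cnj (v $ i) * D $ i) * cnj (cnj (v $ j) * D $ j))
        + (if i = j then cnj (v $ i) * v $ j else 0))"
    unfolding sesq_form_def conjugate_mult_mat_vec_sum[OF coherence_mat_carrier[OF A D] v v]
    by (intro sum.cong refl) (auto simp: coherence_mat_index[OF A D] algebra_simps)
  also have "\<dots> = of_real q * (sesq_form v A
      - (\<Sum>i<n. \<Sum>j<n. (cnj (v $ i) * D $ i) * cnj (cnj (v $ j) * D $ j))) + conjugate v \<bullet> v"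
    unfolding sesq_form_def conjugate_mult_mat_vec_sum[OF A v v] one
    by (simp only: sum.distrib sum_subtractf sum_distrib_left[symmetric])
  \<comment> \<open>The double sum of the rank-one part factors into v^H D and its
    conjugate.\<close>
  also have "(\<Sum>i<n. \<Sum>j<n. (cnj (v $ i) * D $ i) * cnj (cnj (v $ j) * D $ j))
      = (conjugate v \<bullet> D) * cnj (conjugate v \<bullet> D)"
    unfolding x cnj_sum by (rule sum_product[symmetric])
  finally show ?thesis .
qed

text \<open>\<open>u\<close> solves the normal equations of linear prediction, so no inverse of
  \<open>A\<close> has to be mentioned, and 1 - u^H A u is the prediction error.\<close>

locale predictable =
  fixes A :: "complex mat" and D u :: "complex vec" and n :: nat and q \<epsilon> :: real
  assumes A: "A \<in> carrier_mat n n" "psd_mat A"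
    and D: "D \<in> carrier_vec n" and u: "u \<in> carrier_vec n"
    and Au: "A *\<^sub>v u = D" and error: "Re (sesq_form u A) \<le> 1 - \<epsilon>"
    and \<epsilon>: "\<epsilon> > 0" and q: "q > 0"
begin

abbreviation M where "M \<equiv> coherence_mat q A D"

lemma M_carrier: "M \<in> carrier_mat n n"
  by (rule coherence_mat_carrier[OF A(1) D])

text \<open>The excess of v^H A v over |v^H D|^2 is scaled by q, and the identity part of M adds v^H
  v. The first summand will bound the inverse form, the second makes M definite.\<close>

lemma sesq_form_M_ge:
  assumes v: "v \<in> carrier_vec n"
  shows "of_real (q * \<epsilon> * (cmod (conjugate v \<bullet> D))\<^sup>2) + conjugate v \<bullet> v \<le> sesq_form v M"
proof -
  let ?x = "conjugate v \<bullet> D"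
  \<comment> \<open>The order on complex numbers also demands equal imaginary parts, so v^H A v must
    be known to be real.\<close>
  have "0 \<le> sesq_form v A" using A v by (auto simp: psd_mat_def)
  then have im: "Im (sesq_form v A) = 0" by (simp add: less_eq_complex_def)
  have "(1 + \<epsilon>) * (cmod ?x)\<^sup>2 \<le> (2 - Re (sesq_form u A)) * (cmod ?x)\<^sup>2"
    using error by (intro mult_right_mono) auto
  also have "\<dots> \<le> Re (sesq_form v A)"
    using psd_form_lower_bound[OF A v u] by (simp add: Au)
  finally have "q * (\<epsilon> * (cmod ?x)\<^sup>2) \<le> q * (Re (sesq_form v A) - (cmod ?x)\<^sup>2)"
    using q by (intro mult_left_mono) (auto simp: algebra_simps)
  then show ?thesis
    unfolding sesq_form_coherence_mat[OF A(1) D v] complex_norm_square[symmetric]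
    using im by (simp add: less_eq_complex_def mult.assoc)
qed

lemma M_psd: "psd_mat M"
  unfolding psd_mat_def
proof (intro conjI ballI)
  show "hermitian_mat M"
    using A(2) by (intro coherence_mat_hermitian[OF A(1) _ D]) (simp add: psd_mat_def)
  fix v :: "complex vec"
  assume "v \<in> carrier_vec (dim_row M)"
  then have v: "v \<in> carrier_vec n" using M_carrier by auto
  have "0 \<le> conjugate v \<bullet> v"
    using conjugate_square_ge_0_vec[of v] conjugate_vec_sprod_comm[OF v v] by simp
  moreover have "(0::complex) \<le> of_real (q * \<epsilon> * (cmod (conjugate v \<bullet> D))\<^sup>2)"
    using q \<epsilon> by (simp add: less_eq_complex_def)
  ultimately have "0 \<le> of_real (q * \<epsilon> * (cmod (conjugate v \<bullet> D))\<^sup>2) + conjugate v \<bullet> v"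
    by (rule add_nonneg_nonneg[rotated])
  then show "0 \<le> sesq_form v M" using sesq_form_M_ge[OF v] by (rule order_trans)
qed

text \<open>A nonzero null vector v would give v^H M v = 0, although this form is at least v^H v >
  0.\<close>

lemma M_Units: "M \<in> Units (ring_mat TYPE(complex) n ())"
proof (rule det_non_zero_imp_unit[OF M_carrier], rule notI)
  assume "det M = 0"
  then obtain v where v: "v \<in> carrier_vec n" "v \<noteq> 0\<^sub>v n" "M *\<^sub>v v = 0\<^sub>v n"
    using det_0_iff_vec_prod_zero[OF M_carrier] by auto
  have "0 < conjugate v \<bullet> v"
    using v conjugate_vec_sprod_comm[OF v(1) v(1)] conjugate_square_greater_0_vec[OF v(1)] by simp
  moreover have "(0::complex) \<le> of_real (q * \<epsilon> * (cmod (conjugate v \<bullet> D))\<^sup>2)"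
    using q \<epsilon> by (simp add: less_eq_complex_def)
  ultimately have "0 < sesq_form v M"
    using sesq_form_M_ge[OF v(1)] by (auto simp: less_eq_complex_def less_complex_def)
  then show False using v by (simp add: sesq_form_def)
qed

text \<open>The maximizer of 2 Re (v^H D) - v^H M v: stationarity there reads M v = D.\<close>

definition w where "w = inv_mat M *\<^sub>v D"

lemma w_carrier: "w \<in> carrier_vec n"
  using inv_mat_right(1)[OF M_carrier M_Units] D by (simp add: w_def)

lemma M_w: "M *\<^sub>v w = D"
  using inv_mat_right[OF M_carrier M_Units] D M_carrier unfolding w_def
  by (metis assoc_mult_mat_vec one_mult_mat_vec)

text \<open>D^H w = (M w)^H w is the conjugate of w^H M w, which is real since M is
  Hermitian.\<close>

lemma sesq_form_inv: "sesq_form D (inv_mat M) = sesq_form w M"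
proof -
  have "sesq_form D (inv_mat M) = conjugate D \<bullet> w" by (simp add: sesq_form_def w_def)
  also have "\<dots> = cnj (conjugate w \<bullet> D)"
    using conjugate_conjugate_sprod[OF w_carrier D] conjugate_vec_sprod_comm[OF w_carrier D] by simp
  also have "\<dots> = sesq_form w M"
    using hermitian_form_swap[OF M_carrier _ w_carrier w_carrier] M_psd
    by (simp add: psd_mat_def sesq_form_def M_w)
  finally show ?thesis .
qed

lemma inv_form_nonneg: "0 \<le> sesq_form D (inv_mat M)"
  unfolding sesq_form_inv using M_psd w_carrier M_carrier by (auto simp: psd_mat_def)

lemma inv_form_ge:
  assumes "v \<in> carrier_vec n"
  shows "2 * Re (conjugate v \<bullet> D) - Re (sesq_form v M) \<le> Re (sesq_form D (inv_mat M))"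
  using sesq_form_variational[OF M_carrier M_psd assms w_carrier]
  by (simp add: sesq_form_inv M_w)

text \<open>Since M w = D, the bound of \<open>inv_form_ge\<close> is attained at
  \<open>w\<close>.\<close>

lemma inv_form_eq:
  "Re (sesq_form D (inv_mat M)) = 2 * Re (conjugate w \<bullet> D) - Re (sesq_form w M)"
  by (simp add: sesq_form_inv) (simp add: sesq_form_def M_w)

lemma inv_form_le: "Re (sesq_form D (inv_mat M)) \<le> 1 / (q * \<epsilon>)"
proof -
  let ?x = "cmod (conjugate w \<bullet> D)" and ?a = "q * \<epsilon>"
  have a: "?a > 0" using q \<epsilon> by simp
  have "0 \<le> conjugate w \<bullet> w"
    using conjugate_square_ge_0_vec[of w] conjugate_vec_sprod_comm[OF w_carrier w_carrier] by simp
  then have "?a * ?x\<^sup>2 \<le> Re (sesq_form w M)"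
    using sesq_form_M_ge[OF w_carrier] by (simp add: less_eq_complex_def)
  moreover have "Re (conjugate w \<bullet> D) \<le> ?x" by (rule complex_Re_le_cmod)
  ultimately have "Re (sesq_form D (inv_mat M)) \<le> 2 * ?x - ?a * ?x\<^sup>2"
    unfolding inv_form_eq by linarith
  \<comment> \<open>Completing the square in |w^H D|.\<close>
  also have "\<dots> = 1 / ?a - (?a * ?x - 1)\<^sup>2 / ?a"
    using q \<epsilon> by (simp add: field_simps power2_eq_square)
  also have "\<dots> \<le> 1 / ?a" using a by simp
  finally show ?thesis .
qed

end

section \<open>Passing from k to k + 1 by the Toeplitz shift\<close>

lemma sesq_form_vCons_0:
  assumes B: "B \<in> carrier_mat (Suc n) (Suc n)" and A: "A \<in> carrier_mat n n"
    and v: "v \<in> carrier_vec n"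
    and shift: "\<And>i j. i < n \<Longrightarrow> j < n \<Longrightarrow> B $$ (Suc i, Suc j) = A $$ (i, j)"
  shows "sesq_form (vCons 0 v) B = sesq_form v A"
proof -
  have v': "vCons 0 v \<in> carrier_vec (Suc n)" using v by simp
  show ?thesis
    \<comment> \<open>Both index sums lose their first term, which carries the factor 0.\<close>
    unfolding sesq_form_def conjugate_mult_mat_vec_sum[OF B v' v'] conjugate_mult_mat_vec_sum[OF A v v]
    using v by (simp add: sum.lessThan_Suc_shift shift del: sum.lessThan_Suc)
qed

context
  fixes \<Delta> :: "nat \<Rightarrow> complex mat"
  assumes \<Delta>: "stationary_covariances \<Delta>"
begin

lemma cov_carrier: "\<Delta> k \<in> carrier_mat (Suc k) (Suc k)"
  and cov_psd: "psd_mat (\<Delta> k)"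
  using \<Delta> by (simp_all add: stationary_covariances_def)

lemma cov_shift: "i < k \<Longrightarrow> j < k \<Longrightarrow> \<Delta> k $$ (Suc i, Suc j) = \<Delta> k $$ (i, j)"
proof -
  assume "i < k" "j < k"
  moreover have "toeplitz_mat (\<Delta> k)" using \<Delta> by (simp add: stationary_covariances_def)
  ultimately show ?thesis using cov_carrier[of k] unfolding toeplitz_mat_def by auto
qed

lemma cov_restrict: "i \<le> k \<Longrightarrow> j \<le> k \<Longrightarrow> \<Delta> (Suc k) $$ (i, j) = \<Delta> k $$ (i, j)"
proof -
  assume ij: "i \<le> k" "j \<le> k"
  have "\<forall>k\<ge>1. \<Delta> (k - 1) = leading_principal k (\<Delta> k)"
    using \<Delta> by (simp add: stationary_covariances_def)
  from this[rule_format, of "Suc k"] show ?thesis using ij by (simp add: leading_principal_def)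
qed

text \<open>Entry i of D_k belongs to time lag k - i, so raising k puts the new, longest lag in
  front and moves the old entries up by one.\<close>

lemma cov_vec_Suc: "cov_vec \<Delta> (Suc k) = vCons (\<Delta> (Suc k) $$ (0, Suc k)) (cov_vec \<Delta> k)"
proof (rule eq_vecI)
  fix i assume "i < dim_vec (vCons (\<Delta> (Suc k) $$ (0, Suc k)) (cov_vec \<Delta> k))"
  then show "cov_vec \<Delta> (Suc k) $ i = vCons (\<Delta> (Suc k) $$ (0, Suc k)) (cov_vec \<Delta> k) $ i"
    by (cases i) (simp_all add: cov_vec_def cov_shift cov_restrict)
qed (simp add: cov_vec_def)

text \<open>The old M is the lower right block of the new one, because this holds for the covariance
  matrix, the outer product and the identity separately.\<close>

lemma coherence_mat_shift:
  assumes "i < Suc k" "j < Suc k"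
  shows "coherence_mat q (\<Delta> (Suc k)) (cov_vec \<Delta> (Suc (Suc k))) $$ (Suc i, Suc j) =
    coherence_mat q (\<Delta> k) (cov_vec \<Delta> (Suc k)) $$ (i, j)"
proof -
  have D: "cov_vec \<Delta> m \<in> carrier_vec m" for m by (simp add: cov_vec_def)
  show ?thesis
    using assms
    by (simp add: coherence_mat_index[OF cov_carrier D, of "Suc i" "Suc k" "Suc j" q]
      coherence_mat_index[OF cov_carrier D, of i k j q])
      (simp add: cov_vec_Suc[of "Suc k"] cov_shift cov_restrict)
qed

end

section \<open>Convergence in k and a bound on the limit\<close>

lemma coherence_term_Suc:
  "coherence_term \<Delta> N p (Suc k) = sesq_form (cov_vec \<Delta> (Suc k))
     (inv_mat (coherence_mat (real N * p) (\<Delta> k) (cov_vec \<Delta> (Suc k))))"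
  by (simp add: coherence_term_def coherence_mat_def cov_vec_def)

text \<open>Monotone convergence: from some index on, the terms are real, increasing and bounded by
  a constant that does not depend on k.\<close>

lemma coherence_term_limit:
  assumes N: "N \<ge> 1" and \<Delta>: "stationary_covariances \<Delta>"
    and inv: "\<And>k. k \<ge> 1 \<Longrightarrow> invertible_mat (\<Delta> (k - 1))"
    and error: "\<forall>\<^sub>F k in sequentially. Re (prediction_error \<Delta> k) \<ge> \<delta>"
    and \<delta>: "\<delta> > 0" and p: "p > 0"
  shows "convergent (coherence_term \<Delta> N p)"
    and "cmod (lim (coherence_term \<Delta> N p)) \<le> 1 / (real N * p * \<delta>)"
proof -
  define q where "q = real N * p"
  define u where "u = (\<lambda>k. inv_mat (\<Delta> k) *\<^sub>v cov_vec \<Delta> (Suc k))"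
  have q: "q > 0" using N p by (simp add: q_def)
  obtain K where K: "\<And>k. k \<ge> K \<Longrightarrow> Re (prediction_error \<Delta> k) \<ge> \<delta>"
    using error by (auto simp: eventually_sequentially)
  \<comment> \<open>Index k here stands for the term \<open>Suc k\<close>: \<Delta> k and D_{k+1}
    both have size k + 1, and no truncated subtraction occurs.\<close>
  have pred: "predictable (\<Delta> k) (cov_vec \<Delta> (Suc k)) (u k) (Suc k) q \<delta>" if k: "k \<ge> K" for k
  proof -
    have D: "cov_vec \<Delta> (Suc k) \<in> carrier_vec (Suc k)" by (simp add: cov_vec_def)
    have A: "\<Delta> k \<in> carrier_mat (Suc k) (Suc k)" "psd_mat (\<Delta> k)"
      using cov_carrier[OF \<Delta>] cov_psd[OF \<Delta>] by auto
    have "invertible_mat (\<Delta> k)" using inv[of "Suc k"] by simp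
    from inv_mat_right[OF A(1) invertible_mat_Units[OF A(1) this]]
    have I: "inv_mat (\<Delta> k) \<in> carrier_mat (Suc k) (Suc k)" "\<Delta> k * inv_mat (\<Delta> k) = 1\<^sub>m (Suc k)" .
    have u: "u k \<in> carrier_vec (Suc k)" using I D by (simp add: u_def)
    have Au: "\<Delta> k *\<^sub>v u k = cov_vec \<Delta> (Suc k)"
      unfolding u_def using I D A by (metis assoc_mult_mat_vec one_mult_mat_vec)
    \<comment> \<open>The definition yields D^H u = (\<Delta> k u)^H u, the conjugate of u^H
      \<Delta> k u; both have the same real part.\<close>
    have "prediction_error \<Delta> (Suc k) = 1 - conjugate (\<Delta> k *\<^sub>v u k) \<bullet> u k"
      by (simp add: prediction_error_def sesq_form_def Au) (simp add: u_def)
    also have "conjugate (\<Delta> k *\<^sub>v u k) \<bullet> u k = cnj (sesq_form (u k) (\<Delta> k))"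
      using conjugate_conjugate_sprod[OF u D] conjugate_vec_sprod_comm[OF u D]
      by (simp add: Au sesq_form_def)
    finally have "Re (sesq_form (u k) (\<Delta> k)) \<le> 1 - \<delta>" using K[of "Suc k"] k by simp
    then show ?thesis using A D u Au \<delta> q by unfold_locales
  qed
  \<comment> \<open>The error bound is available only from \<open>K\<close> on, hence the offset.
    These terms are nonnegative reals, so \<open>Re\<close> loses nothing.\<close>
  define f where "f = (\<lambda>k. Re (coherence_term \<Delta> N p (Suc (k + K))))"
  have f: "coherence_term \<Delta> N p (Suc (k + K)) = of_real (f k)" "0 \<le> f k" "f k \<le> 1 / (q * \<delta>)" for k
    using predictable.inv_form_nonneg[OF pred[of "k + K"]] predictable.inv_form_le[OF pred[of "k + K"]]
    by (auto simp: f_def coherence_term_Suc q_def less_eq_complex_def complex_eq_iff)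
  have "f k \<le> f (Suc k)" for k
  proof -
    interpret a: predictable "\<Delta> (k + K)" "cov_vec \<Delta> (Suc (k + K))" "u (k + K)" "Suc (k + K)" q \<delta>
      by (rule pred) simp
    interpret b: predictable "\<Delta> (Suc (k + K))" "cov_vec \<Delta> (Suc (Suc (k + K)))" "u (Suc (k + K))"
        "Suc (Suc (k + K))" q \<delta>
      by (rule pred) simp
    \<comment> \<open>The old maximizer padded by a leading 0 serves as trial vector: the new
      functional takes the old maximum there, so the new maximum is at least as large.\<close>
    have "sesq_form (vCons 0 a.w) b.M = sesq_form a.w a.M"
      by (rule sesq_form_vCons_0[OF b.M_carrier a.M_carrier a.w_carrier])
        (rule coherence_mat_shift[OF \<Delta>])
    moreover have "conjugate (vCons 0 a.w) \<bullet> cov_vec \<Delta> (Suc (Suc (k + K)))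
        = conjugate a.w \<bullet> cov_vec \<Delta> (Suc (k + K))"
      by (simp add: cov_vec_Suc[OF \<Delta>, of "Suc (k + K)"])
    moreover have "vCons 0 a.w \<in> carrier_vec (Suc (Suc (k + K)))" using a.w_carrier by simp
    ultimately show ?thesis
      using b.inv_form_ge[of "vCons 0 a.w"] a.inv_form_eq
      by (simp add: f_def coherence_term_Suc q_def)
  qed
  then have "incseq f" by (rule incseq_SucI)
  then obtain L where L: "f \<longlonglongrightarrow> L" using incseq_convergent f(3) by metis
  have "0 \<le> L" "L \<le> 1 / (q * \<delta>)"
    using L f(2,3) by (auto intro: LIMSEQ_le_const LIMSEQ_le_const2)
  have "(\<lambda>k. coherence_term \<Delta> N p (k + Suc K)) \<longlonglongrightarrow> of_real L"
    using tendsto_of_real[OF L] by (simp add: f(1))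
  then have lim: "coherence_term \<Delta> N p \<longlonglongrightarrow> of_real L" by (rule LIMSEQ_offset)
  then show "convergent (coherence_term \<Delta> N p)" by (rule convergentI)
  show "cmod (lim (coherence_term \<Delta> N p)) \<le> 1 / (real N * p * \<delta>)"
    unfolding limI[OF lim] using \<open>0 \<le> L\<close> \<open>L \<le> 1 / (q * \<delta>)\<close> by (simp add: q_def)
qed

section \<open>The limit in p\<close>

theorem mainTheorem5:
  fixes \<Delta> :: "nat \<Rightarrow> complex mat" and N :: nat and \<epsilon> :: real
  assumes "N \<ge> 1"
    and "stationary_covariances \<Delta>"
    and "\<And>k. k \<ge> 1 \<Longrightarrow> invertible_mat (\<Delta> (k - 1))"
    and "prediction_error \<Delta> \<longlonglongrightarrow> of_real \<epsilon>"
    and "\<epsilon> > 0"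
  shows "(\<forall>p > 0. convergent (coherence_term \<Delta> N p)) \<and>
         (coherence_time \<Delta> N \<longlongrightarrow> of_nat N) at_top"
proof
  have "(\<lambda>k. Re (prediction_error \<Delta> k)) \<longlonglongrightarrow> \<epsilon>"
    using tendsto_Re[OF assms(4)] by simp
  \<comment> \<open>Convergence to \<epsilon> gives eventual lower bounds only strictly below
    \<epsilon>; half of it is a positive choice.\<close>
  then have "\<forall>\<^sub>F k in sequentially. Re (prediction_error \<Delta> k) > \<epsilon> / 2"
    by (rule order_tendstoD) (use assms(5) in simp)
  then have error: "\<forall>\<^sub>F k in sequentially. Re (prediction_error \<Delta> k) \<ge> \<epsilon> / 2"
    by eventually_elim simp
  \<comment> \<open>The error bound does not involve p, so the same constant serves every p > 0 and
    the limits decay like 1/p.\<close>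
  note limit = coherence_term_limit[OF assms(1-3) error]
  show "\<forall>p > 0. convergent (coherence_term \<Delta> N p)"
    using limit(1) assms(5) by simp
  have "\<forall>\<^sub>F p in at_top. cmod (lim (coherence_term \<Delta> N p)) \<le> 1 / (real N * p * (\<epsilon> / 2))"
    using eventually_gt_at_top[of 0] by eventually_elim (use limit(2) assms(5) in simp)
  moreover have "((\<lambda>p. 1 / (real N * p * (\<epsilon> / 2))) \<longlongrightarrow> 0) at_top"
  proof -
    have "((\<lambda>p. 2 / (real N * \<epsilon>) * inverse p) \<longlongrightarrow> 2 / (real N * \<epsilon>) * 0) at_top"
      by (intro tendsto_mult tendsto_const tendsto_inverse_0_at_top filterlim_ident)
    then show ?thesis by (simp add: field_simps)
  qed
  ultimately have "((\<lambda>p. cmod (lim (coherence_term \<Delta> N p))) \<longlongrightarrow> 0) at_top"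
    by (rule tendsto_sandwich[OF always_eventually _ tendsto_const, rotated]) simp
  then have "((\<lambda>p. lim (coherence_term \<Delta> N p)) \<longlongrightarrow> 0) at_top"
    by (rule tendsto_norm_zero_cancel)
  then have "((\<lambda>p. 2 * of_nat N * lim (coherence_term \<Delta> N p) + of_nat N)
      \<longlongrightarrow> 2 * of_nat N * 0 + of_nat N) at_top"
    by (intro tendsto_intros)
  then show "(coherence_time \<Delta> N \<longlongrightarrow> of_nat N) at_top"
    by (simp add: coherence_time_def[abs_def])
qed

end
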